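(* For any formal weight enumerator $W(x,y)$ of degree $n$ written in the form $W(x,y)=x^n+\sum_{i=d}^n A_i x^{n-i}y^i$ with $A_i\in\mathbf{C}$ and $A_d\neq 0$, we have $$d\leq 4\left[\frac{n-12}{24}\right]+4.$$ The equality holds when $W(x,y)$ is extremal.
   Context: A polynomial $W(x,y)=\sum_{i=0}^n A_i x^{n-i}y^i\in\mathbf{C}[x,y]$ (homogeneous of degree $n$) is called a formal weight enumerator if (i) $A_i\neq 0$ implies $4\mid i$, and (ii) $W\left(\frac{x+y}{\sqrt 2},\frac{x-y}{\sqrt 2}\right)=-W(x,y)$. Such a $W$ is written as $W(x,y)=x^n+\sum_{i=d}^n A_i x^{n-i}y^i$ with $A_d\neq 0$. A formal weight enumerator of degree $n$ is called extremal if its $d$ is the largest among all formal weight enumerators of degree $n$. Here $[\cdot]$ denotes the integer part. *)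

theory Defs
  imports Complex_Main "HOL-Computational_Algebra.Polynomial"
begin

text \<open>The ring \<open>\<complex>[x,y]\<close> is represented as \<open>(\<complex>[x])[y]\<close>, that is, by the type
  \<open>complex poly poly\<close>: the outer variable is \<open>y\<close>, the inner one is \<open>x\<close>.\<close>

type_synonym bpoly = "complex poly poly"

definition bconst :: "complex \<Rightarrow> bpoly" where
  "bconst c = [:[:c:]:]"

definition bX :: bpoly where
  "bX = [:[:0, 1:]:]"

definition bY :: bpoly where
  "bY = [:0, 1:]"

text \<open>\<open>bsubst W P Q\<close> is the polynomial \<open>W(P, Q)\<close>.\<close>

definition bsubst :: "bpoly \<Rightarrow> bpoly \<Rightarrow> bpoly \<Rightarrow> bpoly" where
  "bsubst W P Q = poly (map_poly (\<lambda>p. poly (map_poly bconst p) P) W) Q"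

definition formal_weight_enumerator :: "nat \<Rightarrow> bpoly \<Rightarrow> bool" where
  "formal_weight_enumerator n W \<longleftrightarrow>
     (\<exists>A :: nat \<Rightarrow> complex.
        W = (\<Sum>i=0..n. bconst (A i) * bX ^ (n - i) * bY ^ i) \<and>
        (\<forall>i\<le>n. A i \<noteq> 0 \<longrightarrow> 4 dvd i)) \<and>
     bsubst W (bconst (1 / complex_of_real (sqrt 2)) * (bX + bY))
              (bconst (1 / complex_of_real (sqrt 2)) * (bX - bY)) = - W"

text \<open>\<open>W = x\<^sup>n + \<Sum>\<^sub>i\<^sub>\<ge>\<^sub>d A\<^sub>i x\<^sup>n\<^sup>-\<^sup>i y\<^sup>i\<close> with \<open>A\<^sub>d \<noteq> 0\<close>. The term \<open>x\<^sup>n\<close> is the one of index \<open>0\<close>,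
  so the sum starts at a positive index; this makes \<open>d\<close> unique.\<close>

definition normalized_form :: "nat \<Rightarrow> nat \<Rightarrow> (nat \<Rightarrow> complex) \<Rightarrow> bpoly \<Rightarrow> bool" where
  "normalized_form n d A W \<longleftrightarrow>
     1 \<le> d \<and> d \<le> n \<and> A d \<noteq> 0 \<and>
     W = bX ^ n + (\<Sum>i=d..n. bconst (A i) * bX ^ (n - i) * bY ^ i)"

definition extremal :: "nat \<Rightarrow> bpoly \<Rightarrow> bool" where
  "extremal n W \<longleftrightarrow> formal_weight_enumerator n W \<and>
     (\<exists>d A. normalized_form n d A W \<and>
       (\<forall>V e B. formal_weight_enumerator n V \<and> normalized_form n e B V \<longrightarrow> e \<le> d))"

lemma poly_map_poly_bconst:
  "poly (poly (poly (map_poly bconst p) P) q) x = poly p (poly (poly P q) x)"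
  by (induction p) (simp_all add: map_poly_pCons bconst_def algebra_simps)

lemma poly_bsubst:
  "poly (poly (bsubst W P Q) [:y:]) x =
     poly (poly W [:poly (poly Q [:y:]) x:]) (poly (poly P [:y:]) x)"
  by (induction W)
    (simp_all add: bsubst_def map_poly_pCons poly_map_poly_bconst algebra_simps)

end

theory Submission
  imports Defs "HOL-Computational_Algebra.Polynomial_Factorial" "HOL-Computational_Algebra.Field_as_Ring"
begin

text \<open>
  Let \<open>p = xy(x\<^sup>4 - y\<^sup>4)\<close>, a relative invariant of the group generated by the MacWilliams
  rotation \<open>\<sigma>\<close> and \<open>T = diag(1, \<i>)\<close>. For the bound (an argument of Duursma) one applies the
  differential operator \<open>p(D)\<close> to \<open>W\<close>: it kills \<open>x\<^sup>n\<close>, so \<open>F = p(D)W\<close> is divisible by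
  \<open>y\<^bsup>d-5\<^esup>\<close> and, being a relative invariant, by \<open>p\<^bsup>d-5\<^esup>\<close>. The quotient is again a formal weight
  enumerator, of degree \<open>n + 24 - 6d\<close>. Nonzero formal weight enumerators have degree congruent to
  \<open>4\<close> modulo \<open>8\<close> and none has degree \<open>4\<close>, so \<open>6d \<le> n + 12\<close>.

  The bound is attained because the \<open>k + 1\<close> forms \<open>W\<^sub>1\<^sub>2 W\<^sub>8\<^bsup>a-3j\<^esup> p\<^bsup>4j\<^esup>\<close> of degree \<open>n = 8a + 12\<close>,
  \<open>j \<le> k = \<lfloor>a/3\<rfloor>\<close>, begin with \<open>x\<^bsup>n-4j\<^esup>y\<^bsup>4j\<^esup>\<close>; a triangular elimination makes all coefficients
  of index \<open>1, \<dots>, 4k\<close> vanish.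
\<close>

subsection \<open>Partial derivatives and the MacWilliams transform\<close>

definition bev :: "bpoly \<Rightarrow> complex \<Rightarrow> complex \<Rightarrow> complex" where
  "bev W x y = poly (poly W [:y:]) x"

lemma bev_simps [simp]:
  "bev 0 x y = 0" "bev 1 x y = 1" "bev (U + V) x y = bev U x y + bev V x y"
  "bev (U - V) x y = bev U x y - bev V x y" "bev (- V) x y = - bev V x y"
  "bev (U * V) x y = bev U x y * bev V x y" "bev (U ^ k) x y = bev U x y ^ k"
  "bev (numeral w) x y = numeral w"
  "bev (bconst c) x y = c" "bev bX x y = x" "bev bY x y = y"
  by (simp_all add: bev_def bconst_def bX_def bY_def)

lemma bev_sum [simp]: "bev (sum f I) x y = (\<Sum>i\<in>I. bev (f i) x y)"
  by (simp add: bev_def poly_sum)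

lemma bev_bsubst [simp]: "bev (bsubst W P Q) x y = bev W (bev P x y) (bev Q x y)"
  by (simp add: bev_def poly_bsubst)

text \<open>For fixed \<open>y\<close>, agreement at all \<open>x\<close> kills the inner
  polynomial, so the constants \<open>[:y:]\<close> are infinitely many roots of
  \<open>U - V\<close> over an integral domain. Most identities below are checked pointwise by this
  rule.\<close>

lemma bev_eqI:
  assumes "\<And>x y. bev U x y = bev V x y"
  shows "U = V"
proof -
  have "poly (U - V) [:y:] = 0" for y
    using assms by (intro poly_ext) (simp add: bev_def)
  then have "range (\<lambda>y. [:y:]) \<subseteq> {q. poly (U - V) q = 0}"
    by auto
  moreover have "infinite (range (\<lambda>y::complex. [:y:]))"
    by (simp add: finite_image_iff inj_def infinite_UNIV_char_0)
  ultimately have "U - V = 0"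
    using poly_roots_finite finite_subset by blast
  then show ?thesis by simp
qed

definition bdx :: "bpoly \<Rightarrow> bpoly" where
  "bdx = map_poly pderiv"

definition bdy :: "bpoly \<Rightarrow> bpoly" where
  "bdy = pderiv"

lemma coeff_bdx: "coeff (bdx W) i = pderiv (coeff W i)"
  by (simp add: bdx_def coeff_map_poly)

lemma coeff_coeff_bdx: "coeff (coeff (bdx W) i) j = of_nat (Suc j) * coeff (coeff W i) (Suc j)"
  by (simp add: coeff_bdx coeff_pderiv)

lemma coeff_coeff_bdy: "coeff (coeff (bdy W) i) j = of_nat (Suc i) * coeff (coeff W (Suc i)) j"
  by (simp add: bdy_def coeff_pderiv of_nat_poly del: of_nat_Suc)

lemma bdx_add: "bdx (U + V) = bdx U + bdx V"
  by (rule poly_eqI) (simp add: coeff_bdx pderiv_add)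

lemma bdx_diff: "bdx (U - V) = bdx U - bdx V"
  by (rule poly_eqI) (simp add: coeff_bdx pderiv_diff)

lemma bdy_add: "bdy (U + V) = bdy U + bdy V"
  by (simp add: bdy_def pderiv_add)

lemma bdy_diff: "bdy (U - V) = bdy U - bdy V"
  by (simp add: bdy_def pderiv_diff)

lemma bdx_mult: "bdx (U * V) = U * bdx V + V * bdx U"
proof (rule poly_eqI)
  fix k
  have pm: "pderiv (p * q) = p * pderiv q + pderiv p * q" for p q :: "complex poly"
    by (simp add: pderiv_mult mult.commute)
  have "coeff (bdx (U * V)) k = (\<Sum>i\<le>k. pderiv (coeff U i * coeff V (k - i)))"
    using higher_pderiv_sum[of 1] by (simp add: coeff_bdx coeff_mult)
  also have "\<dots> = coeff (U * bdx V + bdx U * V) k"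
    by (simp add: coeff_bdx coeff_mult pm sum.distrib)
  finally show "coeff (bdx (U * V)) k = coeff (U * bdx V + V * bdx U) k"
    by (simp add: mult.commute)
qed

lemma bdy_mult: "bdy (U * V) = U * bdy V + V * bdy U"
  by (simp add: bdy_def pderiv_mult)

lemma bdx_bdy_commute: "bdx (bdy W) = bdy (bdx W)"
  by (intro poly_eqI) (simp add: coeff_coeff_bdx coeff_coeff_bdy)

lemma bdx_gen [simp]: "bdx (bconst c) = 0" "bdx bX = 1" "bdx bY = 0"
  by (simp_all add: bdx_def bconst_def bX_def bY_def map_poly_pCons one_pCons pderiv_pCons)

lemma bdy_gen [simp]: "bdy (bconst c) = 0" "bdy bX = 0" "bdy bY = 1"
  by (simp_all add: bdy_def bconst_def bX_def bY_def pderiv_pCons)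

section \<open>The chain rule and the rotation\<close>

lemma bsubst_pCons: "bsubst (pCons a W) P Q = poly (map_poly bconst a) P + Q * bsubst W P Q"
  by (simp add: bsubst_def map_poly_pCons)

lemma bsubst_add: "bsubst (U + V) P Q = bsubst U P Q + bsubst V P Q"
  by (rule bev_eqI) simp

lemma bsubst_diff: "bsubst (U - V) P Q = bsubst U P Q - bsubst V P Q"
  by (rule bev_eqI) simp

lemma bsubst_0: "bsubst 0 P Q = 0"
  by (simp add: bsubst_def)

text \<open>\<open>D\<close> is any derivation that kills the constants, so that one proof serves
  both \<open>bdx\<close> and \<open>bdy\<close>.\<close>

lemma chain_rule_inner:
  assumes add: "\<And>U V. D (U + V) = D U + D V"
    and mult: "\<And>U V. D (U * V) = U * D V + V * D U"
    and const: "\<And>c. D (bconst c) = (0 :: bpoly)"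
  shows "D (poly (map_poly bconst a) P) = D P * poly (map_poly bconst (pderiv a)) P"
proof (induction a)
  case 0
  then show ?case using const[of 0] by (simp add: bconst_def)
next
  case (pCons c a)
  have "poly (map_poly bconst (a + pCons 0 b)) P =
      poly (map_poly bconst a) P + P * poly (map_poly bconst b) P" for b
    by (rule bev_eqI) (simp add: bev_def poly_map_poly_bconst)
  with pCons show ?case
    by (simp add: map_poly_pCons bconst_def[of 0] pderiv_pCons add mult const algebra_simps)
qed

lemma chain_rule:
  assumes add: "\<And>U V. D (U + V) = D U + D V"
    and mult: "\<And>U V. D (U * V) = U * D V + V * D U"
    and const: "\<And>c. D (bconst c) = (0 :: bpoly)"
  shows "D (bsubst W P Q) = D P * bsubst (bdx W) P Q + D Q * bsubst (bdy W) P Q"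
proof (induction W)
  case 0
  then show ?case
    using const[of 0] by (simp add: bdx_def bdy_def bsubst_0 bconst_def)
next
  case (pCons a W)
  have x: "bdx (pCons a W) = pCons (pderiv a) (bdx W)"
    by (simp add: bdx_def map_poly_pCons)
  have y: "bdy (pCons a W) = W + pCons 0 (bdy W)"
    by (simp add: bdy_def pderiv_pCons)
  show ?case
    by (simp add: x y bsubst_pCons bsubst_add add mult pCons.IH algebra_simps
        chain_rule_inner[of D, OF add mult const])
qed

definition rt2 :: complex where
  "rt2 = 1 / complex_of_real (sqrt 2)"

lemma rt2_mult [simp]: "rt2 * rt2 = 1 / 2" "rt2 * (rt2 * z) = z / 2"
proof -
  show *: "rt2 * rt2 = 1 / 2"
    by (simp add: rt2_def flip: of_real_mult)
  show "rt2 * (rt2 * z) = z / 2"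
    by (simp add: mult.assoc[symmetric] *)
qed

lemma rt2_powers: "rt2 ^ 4 = 1 / 4" "rt2 ^ 8 = 1 / 16" "rt2 ^ 12 = 1 / 64"
proof -
  show 4: "rt2 ^ 4 = 1 / 4" by (simp add: eval_nat_numeral)
  have "rt2 ^ 8 = (rt2 ^ 4) ^ 2" "rt2 ^ 12 = (rt2 ^ 4) ^ 3"
    by (simp_all flip: power_mult)
  then show "rt2 ^ 8 = 1 / 16" "rt2 ^ 12 = 1 / 64"
    by (simp_all only: 4 power_divide power_one) simp_all
qed

definition macwilliams :: "bpoly \<Rightarrow> bpoly" where
  "macwilliams W = bsubst W (bconst rt2 * (bX + bY)) (bconst rt2 * (bX - bY))"

lemma bev_macwilliams [simp]: "bev (macwilliams W) x y = bev W (rt2 * (x + y)) (rt2 * (x - y))"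
  by (simp add: macwilliams_def)

lemma bev_anti_invariant:
  assumes "macwilliams W = - W"
  shows "bev W (rt2 * (x + y)) (rt2 * (x - y)) = - bev W x y"
  using arg_cong[OF assms, of "\<lambda>V. bev V x y"] by simp

lemma bdx_macwilliams: "bdx (macwilliams W) = bconst rt2 * macwilliams (bdx W + bdy W)"
  unfolding macwilliams_def
  by (subst chain_rule[of bdx, OF bdx_add bdx_mult])
    (simp_all add: bdx_mult bdx_add bdx_diff bsubst_add algebra_simps)

lemma bdy_macwilliams: "bdy (macwilliams W) = bconst rt2 * macwilliams (bdx W - bdy W)"
  unfolding macwilliams_def
  by (subst chain_rule[of bdy, OF bdy_add bdy_mult])
    (simp_all add: bdy_mult bdy_add bdy_diff bsubst_diff algebra_simps)

text \<open>The factors \<open>xy\<close>, \<open>x\<^sup>2 - y\<^sup>2\<close>, \<open>x\<^sup>2 + y\<^sup>2\<close> of \<open>p\<close>: the rotation exchanges the first two, up to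
  scalars, and fixes the third.\<close>
definition bdA :: "bpoly \<Rightarrow> bpoly" where "bdA V = bdx (bdy V)"
definition bdB :: "bpoly \<Rightarrow> bpoly" where "bdB V = bdx (bdx V) - bdy (bdy V)"
definition bdC :: "bpoly \<Rightarrow> bpoly" where "bdC V = bdx (bdx V) + bdy (bdy V)"

lemma bdx_bconst: "bdx (bconst c * V) = bconst c * bdx V"
  by (simp add: bdx_mult)

lemma bdy_bconst: "bdy (bconst c * V) = bconst c * bdy V"
  by (simp add: bdy_mult)

lemmas bd_simps = bdx_macwilliams bdy_macwilliams bdx_bconst bdy_bconst bdx_add bdx_diff bdy_add bdy_diff
  bdx_bdy_commute

text \<open>Under the rotation the partial derivatives become \<open>rt2\<close> times their sum and
  difference, whose product is half of \<open>dx^2 - dy^2\<close>.\<close>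

lemma bdA_macwilliams: "bdA (macwilliams V) = bconst (1 / 2) * macwilliams (bdB V)"
  by (rule bev_eqI)
    (simp add: bdA_def bdB_def bd_simps algebra_simps flip: add_divide_distrib diff_divide_distrib)

lemma bdB_macwilliams: "bdB (macwilliams V) = bconst 2 * macwilliams (bdA V)"
  by (rule bev_eqI)
    (simp add: bdA_def bdB_def bd_simps algebra_simps flip: add_divide_distrib diff_divide_distrib)

lemma bdC_macwilliams: "bdC (macwilliams V) = macwilliams (bdC V)"
  by (rule bev_eqI)
    (simp add: bdC_def bd_simps algebra_simps flip: add_divide_distrib diff_divide_distrib)

subsection \<open>Homogeneous forms and relative invariants\<close>

text \<open>The outer index \<open>i\<close> is the exponent of \<open>y\<close>, the inner index
  \<open>j\<close> that of \<open>x\<close>; zero is homogeneous of every degree.\<close>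

definition homogeneous :: "nat \<Rightarrow> bpoly \<Rightarrow> bool" where
  "homogeneous n W \<longleftrightarrow> (\<forall>i j. coeff (coeff W i) j \<noteq> 0 \<longrightarrow> i + j = n)"

lemma bmonom_eq: "bconst c * bX ^ a * bY ^ i = monom (monom c a) i"
proof -
  have x: "bX ^ a = [:monom 1 a:]" for a
    by (induction a) (simp_all add: bX_def one_pCons monom_Suc monom_0)
  have y: "bY ^ i = monom 1 i"
    by (induction i) (simp_all add: bY_def one_pCons monom_Suc monom_0 flip: one_pCons)
  show ?thesis
    by (simp add: x y bconst_def smult_monom)
qed

lemma coeff_bsum:
  "coeff (coeff (\<Sum>i=0..n. bconst (a i) * bX ^ (n - i) * bY ^ i) k) j =
     (if k + j = n then a k else 0)"
proof -
  have "coeff (coeff (\<Sum>i=0..n. bconst (a i) * bX ^ (n - i) * bY ^ i) k) j =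
      (\<Sum>i=0..n. if i = k then (if k + j = n then a k else 0) else 0)"
    unfolding bmonom_eq coeff_sum by (rule sum.cong) auto
  then show ?thesis by auto
qed

lemma homogeneous_expand:
  assumes "homogeneous n W"
  shows "W = (\<Sum>i=0..n. bconst (coeff (coeff W i) (n - i)) * bX ^ (n - i) * bY ^ i)"
  by (intro poly_eqI, subst coeff_bsum) (use assms in \<open>auto simp: homogeneous_def\<close>)

lemma bev_homogeneous:
  assumes "homogeneous n W"
  shows "bev W x y = (\<Sum>i=0..n. coeff (coeff W i) (n - i) * x ^ (n - i) * y ^ i)"
  by (subst homogeneous_expand[OF assms]) simp

text \<open>Used with \<open>z = \<i>\<close> and \<open>z = -1\<close>: a congruence on the
  exponents of \<open>y\<close> makes the form an eigenvector of a diagonal map, with eigenvalue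
  \<open>w\<close>.\<close>

lemma bev_rotate:
  assumes W: "homogeneous n W" and r: "\<And>i j. coeff (coeff W i) j \<noteq> 0 \<Longrightarrow> z ^ i = w"
  shows "bev W x (z * y) = w * bev W x y"
  unfolding bev_homogeneous[OF W] sum_distrib_left
proof (rule sum.cong[OF refl])
  fix i
  show "coeff (coeff W i) (n - i) * x ^ (n - i) * (z * y) ^ i =
      w * (coeff (coeff W i) (n - i) * x ^ (n - i) * y ^ i)"
    using r[of i "n - i"] by (cases "coeff (coeff W i) (n - i) = 0") (auto simp: power_mult_distrib)
qed

lemma bev_scale:
  assumes W: "homogeneous n W"
  shows "bev W (z * x) (z * y) = z ^ n * bev W x y"
  unfolding bev_homogeneous[OF W] sum_distrib_left
proof (rule sum.cong[OF refl])
  fix i assume "i \<in> {0..n}"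
  then have "z ^ n = z ^ (n - i) * z ^ i" by (simp flip: power_add)
  then show "coeff (coeff W i) (n - i) * (z * x) ^ (n - i) * (z * y) ^ i =
      z ^ n * (coeff (coeff W i) (n - i) * x ^ (n - i) * y ^ i)"
    by (simp add: power_mult_distrib)
qed

section \<open>Divisibility by the linear factors of \<open>p(1, t)\<close>\<close>

lemma coprime_linear:
  fixes c d :: complex
  assumes "c \<noteq> d"
  shows "coprime [:1, -c:] [:1, -d:]"
proof (rule coprimeI)
  fix q assume q: "q dvd [:1, -c:]" "q dvd [:1, -d:]"
  \<comment> \<open>A Bezout identity: the multipliers cancel the linear terms and leave
    \<open>(d - c) / (d - c)\<close>.\<close>
  have "q dvd [:d / (d - c):] * [:1, -c:] - [:c / (d - c):] * [:1, -d:]"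
    using q by (intro dvd_diff dvd_mult)
  also have "[:d / (d - c):] * [:1, -c:] - [:c / (d - c):] * [:1, -d:] = 1"
    using assms by (simp add: one_pCons mult.commute flip: diff_divide_distrib)
  finally show "is_unit q" .
qed

lemma coprime_linear_0: "coprime [:0, 1:] [:1, -d :: complex:]"
proof (rule coprimeI)
  fix q :: "complex poly" assume q: "q dvd [:0, 1:]" "q dvd [:1, -d:]"
  have "q dvd [:d:] * [:0, 1:] + [:1, -d:]"
    using q by (intro dvd_add dvd_mult)
  also have "[:d:] * [:0, 1:] + [:1, -d:] = 1"
    by (simp add: one_pCons)
  finally show "is_unit q" .
qed

text \<open>\<open>p(1, t) = t - t^5\<close> is the product of these five pairwise coprime
  factors.\<close>

lemma linear_powers_dvd:
  fixes f :: "complex poly"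
  assumes "[:0, 1:] ^ e dvd f" "[:1, -1:] ^ e dvd f" "[:1, 1:] ^ e dvd f"
    "[:1, -\<i>:] ^ e dvd f" "[:1, \<i>:] ^ e dvd f"
  shows "[:0, 1, 0, 0, 0, -1:] ^ e dvd f"
proof -
  have ne: "1 \<noteq> - (1::complex)" "\<i> \<noteq> - \<i>" "1 \<noteq> \<i>" "1 \<noteq> - \<i>" "- 1 \<noteq> \<i>" "- 1 \<noteq> - \<i>"
    by (auto simp: complex_eq_iff)
  have cop: "coprime [:1, -1:] [:1, 1 :: complex:]" "coprime [:1, -\<i>:] [:1, \<i>:]"
    "coprime [:1, -1:] [:1, \<i>:]" "coprime [:1, -1:] [:1, -\<i>:]"
    "coprime [:1, 1:] [:1, \<i>:]" "coprime [:1, 1:] [:1, -\<i>:]"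
    "coprime [:0, 1:] [:1, -1 :: complex:]" "coprime [:0, 1:] [:1, 1 :: complex:]"
    "coprime [:0, 1:] [:1, -\<i>:]" "coprime [:0, 1:] [:1, \<i>:]"
    using coprime_linear[OF ne(1)] coprime_linear[OF ne(2)] coprime_linear[OF ne(3)]
      coprime_linear[OF ne(4)] coprime_linear[OF ne(5)] coprime_linear[OF ne(6)]
      coprime_linear_0[of 1] coprime_linear_0[of "-1"] coprime_linear_0[of "\<i>"]
      coprime_linear_0[of "-\<i>"]
    by simp_all
  have "[:0, 1:] ^ e * [:1, -1:] ^ e * [:1, 1:] ^ e * [:1, -\<i>:] ^ e * [:1, \<i>:] ^ e dvd f"
    by (intro divides_mult assms)
      (simp_all only: coprime_mult_left_iff coprime_power_left_iff coprime_power_right_iff cop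
        simp_thms)
  also have "[:0, 1:] ^ e * [:1, -1:] ^ e * [:1, 1:] ^ e * [:1, -\<i>:] ^ e * [:1, \<i>:] ^ e =
     ([:0, 1:] * [:1, -1:] * [:1, 1:] * [:1, -\<i>:] * [:1, \<i>:]) ^ e"
    by (simp only: power_mult_distrib)
  also have "[:0, 1:] * [:1, -1:] * [:1, 1:] * [:1, -\<i>:] * [:1, \<i>:] =
     ([:0, 1, 0, 0, 0, -1:] :: complex poly)"
    by simp
  finally show ?thesis .
qed

lemma i_power_mod4: "\<i> ^ k = \<i> ^ (k mod 4)"
proof -
  have "\<i> ^ 4 = 1" by (simp add: eval_nat_numeral)
  then have "\<i> ^ (4 * (k div 4) + k mod 4) = \<i> ^ (k mod 4)"
    unfolding power_add power_mult by simp
  then show ?thesis by simp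
qed

lemma i_power_3: "k mod 4 = 3 \<Longrightarrow> \<i> ^ k = - \<i>"
  by (subst i_power_mod4) (simp add: power3_eq_cube)

lemma poly_of_bev: "\<exists>k. \<forall>t. poly k t = bev U (poly P t) (poly Q t)"
proof (induction U)
  case 0
  then show ?case by (auto intro: exI[of _ 0])
next
  case (pCons a U)
  then obtain k where "\<forall>t. poly k t = bev U (poly P t) (poly Q t)" by blast
  then have "\<forall>t. poly (pcompose a P + Q * k) t = bev (pCons a U) (poly P t) (poly Q t)"
    by (simp add: bev_def poly_pcompose)
  then show ?case by blast
qed

text \<open>The interchange of \<open>x\<close> and \<open>y\<close> is \<open>\<sigma>T\<^sup>2\<sigma>\<close>.\<close>
lemma semi_invariant_swap:
  assumes F: "homogeneous N F" and c: "\<And>i j. coeff (coeff F i) j \<noteq> 0 \<Longrightarrow> i mod 4 = 3"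
    and inv: "macwilliams F = - F"
  shows "bev F y x = - bev F x y"
proof -
  have neg: "bev F x (- y) = - bev F x y" for x y
  proof -
    have "(-1) ^ i = (-1 :: complex)" if "coeff (coeff F i) j \<noteq> 0" for i j
    proof -
      from c[OF that] have "odd i" by presburger
      then show ?thesis by simp
    qed
    from bev_rotate[OF F, of "-1" "-1", OF this] show ?thesis by simp
  qed
  note * = bev_anti_invariant[OF inv]
  have "bev F y x = - bev F (rt2 * (y + x)) (rt2 * (y - x))"
    using *[of y x] by simp
  also have "rt2 * (y - x) = - (rt2 * (x - y))"
    by (simp add: algebra_simps)
  finally show ?thesis
    using *[of x y] by (simp add: neg add.commute)
qed

lemma pcompose_power: "pcompose (p ^ k) q = pcompose p q ^ k"
  by (induction k) (simp_all add: pcompose_1 pcompose_mult)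

text \<open>Absence of exponents below \<open>e\<close> gives the factor \<open>y^e\<close>. The
  rotation turns it into \<open>(x - y)^e\<close>, and multiplying \<open>y\<close> by
  \<open>\<i>\<close> moves this through the three remaining linear factors of
  \<open>p\<close>.\<close>

lemma semi_invariant_factor:
  assumes F: "homogeneous N F" and c: "\<And>i j. coeff (coeff F i) j \<noteq> 0 \<Longrightarrow> i mod 4 = 3 \<and> e \<le> i"
    and inv: "macwilliams F = - F"
    and f: "\<And>t. poly f t = bev F 1 t"
  shows "[:0, 1, 0, 0, 0, -1:] ^ e dvd f"
proof -
  have "monom 1 e dvd F"
    unfolding monom_1_dvd_iff' using c by (metis leD leading_coeff_0_iff)
  then obtain K where "F = monom 1 e * K" by (elim dvdE)
  then have FK: "bev F x y = y ^ e * bev K x y" for x y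
    by (simp add: bev_def poly_monom flip: poly_const_pow)
  note * = bev_anti_invariant[OF inv]
  obtain k0 where k0: "poly k0 t = bev K 1 t" for t
    using poly_of_bev[of K 1 "[:0, 1:]"] by auto
  have "f = [:0, 1:] ^ e * k0"
    by (rule poly_ext) (simp add: f FK k0)
  then have d0: "[:0, 1:] ^ e dvd f" by simp
  obtain k1 where k1: "poly k1 t = bev K (rt2 * (1 + t)) (rt2 * (1 - t))" for t
    using poly_of_bev[of K "[:rt2, rt2:]" "[:rt2, - rt2:]"] by (auto simp: algebra_simps)
  have "f = [:1, -1:] ^ e * smult (- (rt2 ^ e)) k1"
  proof (rule poly_ext)
    fix t
    have "poly f t = - bev F (rt2 * (1 + t)) (rt2 * (1 - t))"
      by (simp add: f *)
    then show "poly f t = poly ([:1, -1:] ^ e * smult (- (rt2 ^ e)) k1) t"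
      by (simp add: FK k1 power_mult_distrib)
  qed
  then have d1: "[:1, -1:] ^ e dvd f" by (metis dvd_triv_left)
  have rot: "[:1, - (\<i> * z):] ^ e dvd f" if d: "[:1, - z:] ^ e dvd f" for z
  proof -
    have "bev F 1 (\<i> * t) = - \<i> * bev F 1 t" for t
      by (rule bev_rotate[OF F]) (use c i_power_3 in blast)
    then have A: "pcompose f [:0, \<i>:] = smult (- \<i>) f"
      by (intro poly_ext) (simp add: poly_pcompose f mult.commute)
    obtain q where q: "f = [:1, - z:] ^ e * q" using d by (elim dvdE)
    have "pcompose [:1, - z:] [:0, \<i>:] = [:1, - (\<i> * z):]"
      by (simp add: pcompose_pCons)
    then have "pcompose f [:0, \<i>:] = [:1, - (\<i> * z):] ^ e * pcompose q [:0, \<i>:]"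
      by (simp only: q pcompose_mult pcompose_power)
    then have "smult (- \<i>) f = [:1, - (\<i> * z):] ^ e * pcompose q [:0, \<i>:]"
      by (simp only: A)
    then have "[:1, - (\<i> * z):] ^ e dvd smult (- \<i>) f"
      by (metis dvd_triv_left)
    then show ?thesis by (simp add: dvd_smult_iff)
  qed
  \<comment> \<open>The orbit of \<open>1\<close> under multiplication by
    \<open>\<i>\<close>.\<close>
  have "[:1, -\<i>:] ^ e dvd f" "[:1, 1:] ^ e dvd f" "[:1, \<i>:] ^ e dvd f"
    using rot[of 1] rot[of "\<i>"] rot[of "-1"] d1 by simp_all
  with d0 d1 show ?thesis by (intro linear_powers_dvd) 
qed

text \<open>The degree restrictions on \<open>F = p\<^sup>e G\<close> leave only \<open>G = u x\<^sup>4 + v y\<^sup>4\<close>, and the points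
  \<open>(1, 2)\<close>, \<open>(2, 1)\<close>, \<open>\<sigma>(1, 2)\<close>, at which \<open>p = \<plusminus>30\<close>, force \<open>u = v = 0\<close>.\<close>
lemma semi_invariant_zero:
  assumes F: "homogeneous N F" and c: "\<And>i j. coeff (coeff F i) j \<noteq> 0 \<Longrightarrow> i mod 4 = 3 \<and> e \<le> i"
    and inv: "macwilliams F = - F" and e: "e mod 4 = 3"
    and N: "N mod 8 = 6" "N < 6 * e + 12"
  shows "F = 0"
proof -
  define a where "a i = coeff (coeff F i) (N - i)" for i
  define f where "f = (\<Sum>i=0..N. monom (a i) i)"
  define h where "h = (\<Sum>i=0..N. monom (a i) (N - i))"
  have Fev: "bev F x y = (\<Sum>i=0..N. a i * x ^ (N - i) * y ^ i)" for x y
    using bev_homogeneous[OF F] by (simp add: a_def)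
  have pf: "poly f t = bev F 1 t" for t
    by (simp add: f_def poly_sum poly_monom Fev)
  have ph: "poly h t = bev F t 1" for t
    by (simp add: h_def poly_sum poly_monom Fev)
  have swap: "bev F y x = - bev F x y" for x y
    using semi_invariant_swap[OF F _ inv] c by blast
  \<comment> \<open>\<open>h\<close> is the reversal of \<open>f\<close>. The lower bound
    \<open>e\<close> on the exponents thus becomes the upper bound \<open>N - e\<close> on the
    degree of \<open>f\<close>.\<close>
  have "f = - h"
    by (rule poly_ext) (simp add: pf ph swap[of 1])
  have cf: "coeff f i = (if i \<le> N then a i else 0)" for i
    by (simp add: f_def coeff_sum)
  have ch: "coeff h i = (if i \<le> N then a (N - i) else 0)" for i
  proof -
    have "coeff h i = (\<Sum>j=0..N. if j = N - i then (if i \<le> N then a (N - i) else 0) else 0)"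
      unfolding h_def coeff_sum by (rule sum.cong) auto
    then show ?thesis by simp
  qed
  have F0: "F = 0" if "f = 0"
  proof (intro poly_eqI)
    fix i j
    show "coeff (coeff F i) j = coeff (coeff 0 i) j"
    proof (cases "i + j = N")
      case True
      then have "i \<le> N" "j = N - i" by auto
      then show ?thesis using that cf[of i] by (simp add: a_def)
    next
      case False
      then show ?thesis using F by (auto simp: homogeneous_def)
    qed
  qed
  show ?thesis
  proof (rule ccontr)
    assume "F \<noteq> 0"
    then have f0: "f \<noteq> 0" using F0 by blast
    let ?p = "[:0, 1, 0, 0, 0, -1:] :: complex poly"
    have "?p ^ e dvd f"
      by (rule semi_invariant_factor[OF F _ inv pf]) (use c in blast)
    then obtain g where g: "f = ?p ^ e * g" by (elim dvdE)
    have "i + e \<le> N" if "coeff f i \<noteq> 0" for i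
    proof -
      from that \<open>f = - h\<close> have "i \<le> N" "a (N - i) \<noteq> 0"
        by (auto simp: ch split: if_splits)
      then have "e \<le> N - i" using c[of "N - i" i] by (auto simp: a_def)
      with \<open>i \<le> N\<close> show ?thesis using e c[of "N - i" i] \<open>a (N - i) \<noteq> 0\<close>
        by (cases "e = 0") (auto simp: a_def)
    qed
    then have "degree f + e \<le> N" using f0 by (simp add: leading_coeff_0_iff)
    moreover have "degree f = 5 * e + degree g"
      using f0 by (simp add: g degree_mult_eq degree_power_eq)
    ultimately have dg: "6 * e + degree g \<le> N" by simp
    obtain q where q: "e = 4 * q + 3" using e by (metis div_mult_mod_eq mult.commute)
    obtain m where m: "N = 8 * m + 6" using N(1) by (metis div_mult_mod_eq mult.commute)
    \<comment> \<open>The bounds read \<open>24 q + 12 \<le> 8 m < 24 q + 24\<close>, which leaves a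
      single multiple of 8.\<close>
    have "m = 3 * q + 2" using dg N(2) by (simp add: q m)
    then have N4: "N = 6 * e + 4" by (simp add: q m)
    with dg have "degree g \<le> 4" by simp
    have "bev F 1 (\<i> * t) = - \<i> * bev F 1 t" for t
      by (rule bev_rotate[OF F]) (use c i_power_3 in blast)
    then have "pcompose f [:0, \<i>:] = smult (- \<i>) f"
      by (intro poly_ext) (simp add: poly_pcompose pf mult.commute)
    moreover have "pcompose ?p [:0, \<i>:] = smult \<i> ?p"
      by (simp add: pcompose_pCons)
    then have "pcompose f [:0, \<i>:] = smult (\<i> ^ e) (?p ^ e * pcompose g [:0, \<i>:])"
      by (simp only: g pcompose_mult pcompose_power smult_power mult_smult_left)
    ultimately have "smult (- \<i>) (?p ^ e * pcompose g [:0, \<i>:]) = smult (- \<i>) (?p ^ e * g)"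
      using i_power_3[OF e] g by simp
    then have "smult \<i> (smult (- \<i>) (?p ^ e * pcompose g [:0, \<i>:])) =
        smult \<i> (smult (- \<i>) (?p ^ e * g))"
      by (rule arg_cong)
    then have "?p ^ e * pcompose g [:0, \<i>:] = ?p ^ e * g"
      by (simp only: smult_smult) simp
    moreover have "?p ^ e \<noteq> 0" by simp
    ultimately have gi: "pcompose g [:0, \<i>:] = g"
      by (simp only: mult_cancel_left) simp
    \<comment> \<open>Invariance of \<open>g\<close> under \<open>t -> \<i> t\<close> leaves only
      exponents divisible by 4.\<close>
    have "coeff g k * \<i> ^ k = coeff g k" for k
      using arg_cong[OF gi, of "\<lambda>q. coeff q k"] by (simp add: coeff_pcompose_linear mult.commute)
    from this[of 1] this[of 2] this[of 3]
    have g123: "coeff g 1 = 0" "coeff g 2 = 0" "coeff g 3 = 0"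
      by (auto simp: complex_eq_iff power2_eq_square power3_eq_cube)
    define u v where "u = coeff g 0" and "v = coeff g 4"
    have gt: "poly g t = u + v * t ^ 4" for t
    proof -
      have "poly g t = (\<Sum>i\<le>4. coeff g i * t ^ i)"
        unfolding poly_altdef using \<open>degree g \<le> 4\<close>
        by (intro sum.mono_neutral_left) (auto simp: coeff_eq_0)
      then show ?thesis using g123
        by (simp add: u_def v_def eval_nat_numeral)
    qed
    \<comment> \<open>Homogeneity recovers \<open>F\<close> from \<open>F(1, y / x)\<close>; since
      \<open>N = 6 e + 4\<close>, the power \<open>x^N\<close> splits into \<open>x^6\<close> for
      each factor \<open>p\<close> and \<open>x^4\<close> for the quartic.\<close>
    have ev: "bev F x y = (x * y * (x ^ 4 - y ^ 4)) ^ e * (u * x ^ 4 + v * y ^ 4)" if "x \<noteq> 0" for x y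
    proof -
      have "bev F x y = x ^ N * bev F 1 (y / x)"
        using bev_scale[OF F, of x 1 "y / x"] that by simp
      also have "bev F 1 (y / x) = (y / x - (y / x) ^ 5) ^ e * (u + v * (y / x) ^ 4)"
        by (simp add: pf[symmetric] g gt eval_nat_numeral algebra_simps)
      also have "x ^ N = (x ^ 6) ^ e * x ^ 4"
        by (simp add: N4 power_add power_mult)
      also have "(x ^ 6) ^ e * x ^ 4 * ((y / x - (y / x) ^ 5) ^ e * (u + v * (y / x) ^ 4)) =
          (x ^ 6 * (y / x - (y / x) ^ 5)) ^ e * (x ^ 4 * (u + v * (y / x) ^ 4))"
        by (simp add: power_mult_distrib)
      also have "x ^ 6 * (y / x - (y / x) ^ 5) = x * y * (x ^ 4 - y ^ 4)"
        using that by (simp add: field_simps eval_nat_numeral)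
      also have "x ^ 4 * (u + v * (y / x) ^ 4) = u * x ^ 4 + v * y ^ 4"
        using that by (simp add: power_divide distrib_left)
      finally show ?thesis .
    qed
    have odd: "odd e" using e by presburger
    \<comment> \<open>\<open>p(2, 1) = 30\<close>, \<open>p(1, 2) = -30\<close> and \<open>e\<close>
      is odd, so \<open>16 u + v = u + 16 v\<close> remains.\<close>
    have "bev F 2 1 = - bev F 1 2" by (rule swap)
    then have "u = v" using odd by (simp add: ev)
    \<comment> \<open>At the rotated point \<open>(3 rt2, - rt2)\<close> again
      \<open>p = -30\<close>, so the identity reduces to \<open>82 u / 4 = - 17 u\<close>.\<close>
    have "bev F (rt2 * (1 + 2)) (rt2 * (1 - 2)) = - bev F 1 2"
      by (rule bev_anti_invariant[OF inv])
    moreover have "rt2 \<noteq> 0"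
      by (simp add: rt2_def)
    moreover have "rt2 * 3 * (- rt2) * ((rt2 * 3) ^ 4 - (- rt2) ^ 4) = - 30"
      by (simp add: rt2_powers power_mult_distrib mult.assoc)
    ultimately have "v = 0"
      using \<open>u = v\<close> by (simp add: ev power_mult_distrib rt2_powers)
    with \<open>u = v\<close> gt have "g = 0" by (intro poly_ext) simp
    with g f0 show False by simp
  qed
qed

subsection \<open>The bound on the minimal index\<close>

lemma bd_minus: "bdx (- V) = - bdx V" "bdy (- V) = - bdy V"
  using bdx_diff[of 0 V] bdy_diff[of 0 V] by (simp_all add: bdx_def bdy_def)

definition bdP :: "bpoly \<Rightarrow> bpoly" where
  "bdP W = bdA (bdB (bdC W))"

text \<open>The rotation exchanges the commuting operators \<open>bdA\<close> and
  \<open>bdB\<close>, and the scalars \<open>1 / 2\<close> and \<open>2\<close> cancel; hence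
  \<open>bdP\<close> commutes with it.\<close>

lemma bdP_macwilliams:
  assumes "macwilliams W = - W"
  shows "macwilliams (bdP W) = - bdP W"
proof -
  have "bdP (macwilliams W) = macwilliams (bdP W)"
  proof -
    have comm: "bdB (bdA V) = bdA (bdB V)" for V
      by (simp add: bdA_def bdB_def bd_simps)
    have "bdB (bconst c * V) = bconst c * bdB V" "bdA (bconst c * V) = bconst c * bdA V" for c V
      by (simp_all add: bdA_def bdB_def bd_simps right_diff_distrib)
    then have "bdP (macwilliams W) = bconst 2 * (bconst (1 / 2) * macwilliams (bdB (bdA (bdC W))))"
      by (simp add: bdP_def bdA_macwilliams bdB_macwilliams bdC_macwilliams)
    also have "\<dots> = macwilliams (bdP W)"
      unfolding comm bdP_def by (rule bev_eqI) simp
    finally show ?thesis .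
  qed
  moreover have "bdP (- W) = - bdP W"
    by (simp add: bdP_def bdA_def bdB_def bdC_def bd_minus bdx_add bdx_diff bdy_add bdy_diff)
  ultimately show ?thesis using assms by simp
qed

lemma coeff_bdx4: "coeff (coeff (bdx (bdx (bdx (bdx W)))) i) j =
    of_nat ((j + 1) * (j + 2) * (j + 3) * (j + 4)) * coeff (coeff W i) (j + 4)"
  unfolding coeff_coeff_bdx by (simp add: eval_nat_numeral algebra_simps)

lemma coeff_bdy4: "coeff (coeff (bdy (bdy (bdy (bdy W)))) i) j =
    of_nat ((i + 1) * (i + 2) * (i + 3) * (i + 4)) * coeff (coeff W (i + 4)) j"
  unfolding coeff_coeff_bdy by (simp add: eval_nat_numeral algebra_simps)

text \<open>Since \<open>bdP\<close> is \<open>dx dy (dx^4 - dy^4)\<close>, each coefficient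
  involves just two coefficients of \<open>W\<close>, at the indices \<open>i + 1\<close> and
  \<open>i + 5\<close>.\<close>

lemma coeff_bdP:
  "coeff (coeff (bdP W) i) j = of_nat (Suc j) * (of_nat (Suc i) *
    (of_nat ((Suc j + 1) * (Suc j + 2) * (Suc j + 3) * (Suc j + 4)) * coeff (coeff W (Suc i)) (Suc j + 4) -
     of_nat ((Suc i + 1) * (Suc i + 2) * (Suc i + 3) * (Suc i + 4)) * coeff (coeff W (Suc i + 4)) (Suc j)))"
proof -
  have "bdP W = bdx (bdy (bdx (bdx (bdx (bdx W))) - bdy (bdy (bdy (bdy W)))))"
    by (simp add: bdP_def bdA_def bdB_def bdC_def bd_simps)
  then show ?thesis
    by (simp only: coeff_coeff_bdx[of "bdy _"] coeff_coeff_bdy[of "_ - _"] coeff_diff coeff_bdx4 coeff_bdy4)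
qed

section \<open>Coefficients and degrees of formal weight enumerators\<close>

lemma formal_weight_enumerator_iff:
  "formal_weight_enumerator n W \<longleftrightarrow>
     homogeneous n W \<and> (\<forall>i j. coeff (coeff W i) j \<noteq> 0 \<longrightarrow> 4 dvd i) \<and> macwilliams W = - W"
proof -
  have "(\<exists>A. W = (\<Sum>i=0..n. bconst (A i) * bX ^ (n - i) * bY ^ i) \<and>
      (\<forall>i\<le>n. A i \<noteq> 0 \<longrightarrow> 4 dvd i)) \<longleftrightarrow>
      homogeneous n W \<and> (\<forall>i j. coeff (coeff W i) j \<noteq> 0 \<longrightarrow> 4 dvd i)" (is "?L \<longleftrightarrow> ?R")
  proof
    assume ?L
    then obtain A where A: "W = (\<Sum>i=0..n. bconst (A i) * bX ^ (n - i) * bY ^ i)"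
      "\<forall>i\<le>n. A i \<noteq> 0 \<longrightarrow> 4 dvd i" by blast
    have "coeff (coeff W i) j = (if i + j = n then A i else 0)" for i j
      unfolding A(1) by (rule coeff_bsum)
    with A(2) show ?R by (auto simp: homogeneous_def split: if_splits)
  next
    assume ?R
    then show ?L
      by (intro exI[of _ "\<lambda>i. coeff (coeff W i) (n - i)"]) (auto intro: homogeneous_expand)
  qed
  then show ?thesis
    by (simp add: formal_weight_enumerator_def macwilliams_def rt2_def)
qed

lemma i_power_mod4_0: "4 dvd k \<Longrightarrow> \<i> ^ k = 1"
  by (subst i_power_mod4) (simp add: mod_eq_0_iff_dvd)

text \<open>With \<open>T = diag(1, \<i>)\<close> and \<open>\<sigma>\<close> the Hadamard rotation, \<open>(\<sigma>T)\<^sup>3\<close> is a primitive eighth root of unity.\<close>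
lemma degree_mod_8:
  assumes W: "homogeneous n W" and 4: "\<And>i j. coeff (coeff W i) j \<noteq> 0 \<Longrightarrow> 4 dvd i"
    and inv: "macwilliams W = - W" and nz: "bev W 1 0 \<noteq> 0"
  shows "n mod 8 = 4"
proof -
  define z where "z = rt2 * (1 + \<i>)"
  note M = bev_anti_invariant[OF inv]
  have R: "bev W x (\<i> * y) = bev W x y" for x y
    using bev_rotate[OF W, of "\<i>" 1] 4 i_power_mod4_0 by fastforce
  \<comment> \<open>Three rotations, each changing the sign, and two multiplications of
    \<open>y\<close> by \<open>\<i>\<close> carry \<open>(1, 0)\<close> to
    \<open>(z, 0)\<close>.\<close>
  have "bev W 1 0 = - bev W rt2 rt2"
    using M[of 1 0] by simp
  also have "bev W rt2 rt2 = - bev W ((1 + \<i>) / 2) ((1 - \<i>) / 2)"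
    using M[of rt2 "\<i> * rt2"] R[of rt2 rt2] by (simp add: algebra_simps add_divide_distrib diff_divide_distrib)
  also have "bev W ((1 + \<i>) / 2) ((1 - \<i>) / 2) = bev W ((1 + \<i>) / 2) ((1 + \<i>) / 2)"
    using R[of "(1 + \<i>) / 2" "(1 - \<i>) / 2"] by (simp add: algebra_simps)
  also have "\<dots> = - bev W z 0"
    using M[of "(1 + \<i>) / 2" "(1 + \<i>) / 2"] by (simp add: z_def field_simps)
  finally have "z ^ n * bev W 1 0 = - bev W 1 0"
    using bev_scale[OF W, of z 1 0] by simp
  then have "(z ^ n + 1) * bev W 1 0 = 0" by (simp add: distrib_right)
  with nz have zn: "z ^ n = -1" by (simp add: eq_neg_iff_add_eq_0)
  have z2: "z ^ 2 = \<i>"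
    by (simp add: z_def power2_eq_square algebra_simps add_divide_distrib)
  \<comment> \<open>Squaring \<open>z^n = -1\<close> shows that 4 divides \<open>n\<close>; then
    \<open>z^4 = -1\<close> decides the parity of \<open>n / 4\<close>.\<close>
  have "\<i> ^ n = (z ^ n) ^ 2"
    by (simp flip: z2 power_mult add: mult.commute)
  then have i1: "\<i> ^ (n mod 4) = 1"
    using zn i_power_mod4[of n] by simp
  have "n mod 4 \<in> {0, 1, 2, 3}" by auto
  with i1 have "n mod 4 = 0"
    by (auto simp: complex_eq_iff power2_eq_square power3_eq_cube)
  then obtain m where m: "n = 4 * m" by auto
  have "z ^ 4 = -1"
    using arg_cong[OF z2, of "\<lambda>w. w ^ 2"] by (simp flip: power_mult)
  with zn have "(-1 :: complex) ^ m = -1" by (simp add: m power_mult)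
  then have "odd m" by (cases "even m") auto
  with m show ?thesis by presburger
qed

text \<open>Otherwise \<open>W = x^n + A y^n\<close>, and the rotation at \<open>(1, 0)\<close> and
  \<open>(0, 1)\<close> yields \<open>A = 1\<close> and \<open>2 rt2^n = -1\<close>, against
  positivity. Strictness lets the term of index \<open>d\<close> survive the
  \<open>x\<close>-derivative in \<open>bdP\<close>.\<close>

lemma index_less_degree:
  assumes W: "homogeneous n W" and inv: "macwilliams W = - W" and n: "n mod 8 = 4"
    and c0: "coeff (coeff W 0) n = 1"
    and gap: "\<And>i. 0 < i \<Longrightarrow> i < d \<Longrightarrow> coeff (coeff W i) (n - i) = 0"
    and cd: "coeff (coeff W d) (n - d) \<noteq> 0"
  shows "d < n"
proof (rule ccontr)
  assume "\<not> d < n"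
  moreover have "d \<le> n" using W cd unfolding homogeneous_def by (metis le_add1)
  ultimately have [simp]: "d = n" by simp
  note M = bev_anti_invariant[OF inv]
  define A where "A = coeff (coeff W n) 0"
  have n0: "0 < n" "even n" using n by presburger+
  have ev: "bev W x y = x ^ n + A * y ^ n" for x y
  proof -
    have "bev W x y = (\<Sum>i\<in>{0, n}. coeff (coeff W i) (n - i) * x ^ (n - i) * y ^ i)"
      unfolding bev_homogeneous[OF W] using gap by (intro sum.mono_neutral_right) auto
    then show ?thesis using n0 c0 by (simp add: A_def)
  qed
  have 1: "rt2 ^ n * (1 + A) = -1" using M[of 1 0] n0 by (simp add: ev zero_power algebra_simps)
  have 2: "rt2 ^ n * (1 + A) = - A" using M[of 0 1] n0 by (simp add: ev zero_power algebra_simps)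
  have "rt2 ^ n * 2 = -1" using 1 2 by simp
  moreover have "rt2 ^ n * 2 = complex_of_real ((1 / sqrt 2) ^ n * 2)"
    by (simp add: rt2_def)
  ultimately have "(1 / sqrt 2) ^ n * 2 = -1"
    by (metis of_real_eq_iff of_real_1 of_real_minus)
  moreover have "0 < (1 / sqrt 2) ^ n * 2" by simp
  ultimately show False by linarith
qed

lemma minimal_index_bound:
  assumes W: "homogeneous n W" and 4: "\<And>i j. coeff (coeff W i) j \<noteq> 0 \<Longrightarrow> 4 dvd i"
    and inv: "macwilliams W = - W"
    and c0: "coeff (coeff W 0) n = 1" and d: "0 < d"
    and gap: "\<And>i. 0 < i \<Longrightarrow> i < d \<Longrightarrow> coeff (coeff W i) (n - i) = 0"
    and cd: "coeff (coeff W d) (n - d) \<noteq> 0"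
  shows "6 * d \<le> n + 12"
proof (rule ccontr)
  assume less: "\<not> 6 * d \<le> n + 12"
  have "bev W 1 0 = (\<Sum>i\<in>{0}. coeff (coeff W i) (n - i) * 1 ^ (n - i) * 0 ^ i)"
    unfolding bev_homogeneous[OF W] by (intro sum.mono_neutral_right) auto
  then have n: "n mod 8 = 4"
    using c0 by (intro degree_mod_8[OF W 4 inv]) auto
  have dn: "d < n" by (rule index_less_degree[OF W inv n c0 gap cd])
  have "4 dvd d" using 4 cd by blast
  have "d \<noteq> 0" using less by auto
  \<comment> \<open>This makes \<open>d - 5 = 4 q + 3\<close> a natural number.\<close>
  have "d \<noteq> 4"
  proof
    assume "d = 4"
    then have "4 < n" "n < 12" using dn less by simp_all
    with n show False by presburger
  qed
  with \<open>d \<noteq> 0\<close> \<open>4 dvd d\<close> have "d = 4 * (d div 4 - 2) + 8" by presburger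
  then obtain q where q: "d = 4 * q + 8" by blast
  then have "8 \<le> n" using dn by simp
  with n have "n = 8 * (n div 8 - 1) + 12" by presburger
  then obtain m where m: "n = 8 * m + 12" by blast
  have W0: "i + j = n" if "coeff (coeff W i) j \<noteq> 0" for i j
    using W that by (auto simp: homogeneous_def)
  have zero: "coeff (coeff W i) j = 0" if "0 < i" "i < d" for i j
    using gap[OF that] W0[of i j] by (metis add_diff_cancel_left')
  have nz: "coeff (coeff W (Suc i)) (Suc j + 4) \<noteq> 0 \<or> coeff (coeff W (Suc i + 4)) (Suc j) \<noteq> 0"
    if "coeff (coeff (bdP W) i) j \<noteq> 0" for i j
  proof (rule ccontr)
    assume "\<not> ?thesis"
    then have "coeff (coeff W (Suc i)) (Suc j + 4) = 0" "coeff (coeff W (Suc i + 4)) (Suc j) = 0"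
      by blast+
    then have "coeff (coeff (bdP W) i) j = 0"
      by (simp only: coeff_bdP mult_zero_right diff_self)
    with that show False by contradiction
  qed
  \<comment> \<open>With \<open>N = n - 6\<close> and \<open>e = d - 5\<close>, the assumed failure
    of the bound is exactly \<open>N < 6 e + 12\<close>.\<close>
  have "bdP W = 0"
  proof (rule semi_invariant_zero)
    show "homogeneous (n - 6) (bdP W)"
      unfolding homogeneous_def
    proof (intro allI impI)
      fix i j assume "coeff (coeff (bdP W) i) j \<noteq> 0"
      from nz[OF this] have "i + j + 6 = n"
        using W0[of "Suc i" "Suc j + 4"] W0[of "Suc i + 4" "Suc j"] by auto
      then show "i + j = n - 6" by simp
    qed
    show "macwilliams (bdP W) = - bdP W" by (rule bdP_macwilliams[OF inv])
  next
    fix i j assume "coeff (coeff (bdP W) i) j \<noteq> 0"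
    from nz[OF this] have *: "4 dvd Suc i \<or> 4 dvd Suc i + 4" "\<not> Suc i + 4 < d"
      using 4 zero[of "Suc i"] zero[of "Suc i + 4"] by (blast, force)
    from *(1) have "i mod 4 = 3" by presburger
    with *(2) show "i mod 4 = 3 \<and> 4 * q + 3 \<le> i" by (simp add: q)
  next
    show "(4 * q + 3) mod 4 = 3" by presburger
    have "n - 6 = 6 + m * 8" by (simp add: m)
    then show "(n - 6) mod 8 = 6" by (simp only: mod_mult_self1) simp
    show "n - 6 < 6 * (4 * q + 3) + 12" using less by (simp add: q m)
  qed
  \<comment> \<open>This coefficient combines those of \<open>W\<close> at the index
    \<open>d - 4\<close>, which lies in the gap, and at \<open>d\<close>; its vanishing forces the
    latter to vanish.\<close>
  then have "coeff (coeff (bdP W) (4 * q + 3)) (n - d - 1) = 0" by simp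
  moreover have "coeff (coeff W (Suc (4 * q + 3))) (Suc (n - d - 1) + 4) = 0"
    by (intro zero) (auto simp: q)
  ultimately have "coeff (coeff W (Suc (4 * q + 3) + 4)) (Suc (n - d - 1)) = 0"
    unfolding coeff_bdP
    by (simp only: mult_eq_0_iff of_nat_eq_0_iff mult_zero_right diff_0 neg_equal_0_iff_equal) simp
  moreover have "Suc (4 * q + 3) + 4 = d" "Suc (n - d - 1) = n - d"
    using dn by (auto simp: q)
  ultimately show False using cd by simp
qed

subsection \<open>Construction of extremal enumerators\<close>

lemma homogeneous_mult:
  assumes "homogeneous m U" "homogeneous n V"
  shows "homogeneous (m + n) (U * V)"
  unfolding homogeneous_def
proof (intro allI impI)
  fix i j assume "coeff (coeff (U * V) i) j \<noteq> 0"
  then obtain k where k: "k \<le> i" "coeff (coeff U k * coeff V (i - k)) j \<noteq> 0"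
    by (auto simp: coeff_mult[of U V] coeff_sum elim: sum.not_neutral_contains_not_neutral)
  then obtain l where "l \<le> j" "coeff (coeff U k) l \<noteq> 0" "coeff (coeff V (i - k)) (j - l) \<noteq> 0"
    by (auto simp: coeff_mult elim: sum.not_neutral_contains_not_neutral)
  with k assms have "k + l = m" "(i - k) + (j - l) = n" "k \<le> i" "l \<le> j"
    by (auto simp: homogeneous_def)
  then show "i + j = m + n" by simp
qed

definition y_div4 :: "bpoly \<Rightarrow> bool" where
  "y_div4 W \<longleftrightarrow> (\<forall>i. coeff W i \<noteq> 0 \<longrightarrow> 4 dvd i)"

lemma y_div4_mult:
  assumes "y_div4 U" "y_div4 V"
  shows "y_div4 (U * V)"
  unfolding y_div4_def
proof (intro allI impI)
  fix i assume "coeff (U * V) i \<noteq> 0"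
  then obtain k where "k \<le> i" "coeff U k \<noteq> 0" "coeff V (i - k) \<noteq> 0"
    by (auto simp: coeff_mult elim: sum.not_neutral_contains_not_neutral)
  with assms have "4 dvd k" "4 dvd i - k" "k \<le> i" by (auto simp: y_div4_def)
  then show "4 dvd i" by (metis dvd_diffD)
qed

lemma homogeneous_add: "homogeneous n U \<Longrightarrow> homogeneous n V \<Longrightarrow> homogeneous n (U + V)"
  unfolding homogeneous_def by (metis add.right_neutral coeff_add)

lemma homogeneous_diff: "homogeneous n U \<Longrightarrow> homogeneous n V \<Longrightarrow> homogeneous n (U - V)"
  unfolding homogeneous_def by (metis coeff_diff diff_self)

lemma y_div4_add: "y_div4 U \<Longrightarrow> y_div4 V \<Longrightarrow> y_div4 (U + V)"
  unfolding y_div4_def by (metis add.right_neutral coeff_add)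

lemma y_div4_diff: "y_div4 U \<Longrightarrow> y_div4 V \<Longrightarrow> y_div4 (U - V)"
  unfolding y_div4_def by (metis coeff_diff diff_self)

lemma homogeneous_monom: "a + i = n \<Longrightarrow> homogeneous n (monom (monom c a) i)"
  by (auto simp: homogeneous_def)

lemma y_div4_monom: "4 dvd i \<Longrightarrow> y_div4 (monom p i)"
  by (auto simp: y_div4_def)

lemma homogeneous_power: "homogeneous n U \<Longrightarrow> homogeneous (k * n) (U ^ k)"
proof (induction k)
  case 0
  have "(1 :: bpoly) = monom (monom 1 0) 0" by simp
  then show ?case using homogeneous_monom[of 0 0 0 1] by simp
qed (simp add: homogeneous_mult)

lemma y_div4_power: "y_div4 U \<Longrightarrow> y_div4 (U ^ k)"
proof (induction k)
  case 0
  have "(1 :: bpoly) = monom 1 0" by simp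
  then show ?case using y_div4_monom[of 0 1] by simp
qed (simp add: y_div4_mult)

lemma bev_monom [simp]:
  "bev (monom (monom c a) i) x y = c * x ^ a * y ^ i" "bev (monom 1 i) x y = y ^ i"
proof -
  show *: "bev (monom (monom c a) i) x y = c * x ^ a * y ^ i" for c a
    by (simp flip: bmonom_eq)
  show "bev (monom 1 i) x y = y ^ i"
    using *[of 1 0] by simp
qed

text \<open>The weight enumerator of the extended binary Hamming code of length 8.\<close>

definition w8 :: bpoly where
  "w8 = monom (monom 1 8) 0 + monom (monom 14 4) 4 + monom (monom 1 0) 8"

definition w12 :: bpoly where
  "w12 = monom (monom 1 12) 0 - monom (monom 33 8) 4 - monom (monom 33 4) 8 + monom (monom 1 0) 12"

definition w20 :: bpoly where
  "w20 = monom (monom 1 4) 0 * (monom (monom 1 4) 0 - monom (monom 1 0) 4) ^ 4"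

text \<open>This is \<open>p\<^sup>4\<close>; the factor \<open>y\<^sup>4\<close> is split off to read off the leading coefficient.\<close>
definition w24 :: bpoly where
  "w24 = monom 1 4 * w20"

lemma homogeneous_w: "homogeneous 8 w8" "homogeneous 12 w12" "homogeneous 24 w24"
proof -
  show "homogeneous 8 w8" "homogeneous 12 w12"
    unfolding w8_def w12_def by (intro homogeneous_add homogeneous_diff homogeneous_monom; simp)+
  have "homogeneous (4 + (4 + 4 * 4)) w24"
    unfolding w24_def w20_def one_pCons monom_0[symmetric]
    by (intro homogeneous_mult homogeneous_power homogeneous_diff homogeneous_monom) simp_all
  then show "homogeneous 24 w24" by simp
qed

lemma y_div4_w: "y_div4 w8" "y_div4 w12" "y_div4 w24"
  unfolding w8_def w12_def w24_def w20_def
  by (intro y_div4_add y_div4_diff y_div4_mult y_div4_power y_div4_monom; simp)+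

lemma macwilliams_w8: "macwilliams w8 = w8"
proof (rule bev_eqI)
  fix x y :: complex
  have "bev (macwilliams w8) x y =
      ((x + y) ^ 8 + 14 * ((x + y) ^ 4 * (x - y) ^ 4) + (x - y) ^ 8) / 16"
    by (simp add: w8_def power_mult_distrib rt2_powers add_divide_distrib)
  also have "(x + y) ^ 8 + 14 * ((x + y) ^ 4 * (x - y) ^ 4) + (x - y) ^ 8 =
      16 * (x ^ 8 + 14 * (x ^ 4 * y ^ 4) + y ^ 8)"
    by algebra
  finally show "bev (macwilliams w8) x y = bev w8 x y"
    by (simp add: w8_def)
qed

lemma macwilliams_w12: "macwilliams w12 = - w12"
proof (rule bev_eqI)
  fix x y :: complex
  have "bev (macwilliams w12) x y = ((x + y) ^ 12 - 33 * ((x + y) ^ 8 * (x - y) ^ 4) -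
      33 * ((x + y) ^ 4 * (x - y) ^ 8) + (x - y) ^ 12) / 64"
    by (simp add: w12_def power_mult_distrib rt2_powers add_divide_distrib diff_divide_distrib mult.assoc)
  also have "(x + y) ^ 12 - 33 * ((x + y) ^ 8 * (x - y) ^ 4) -
      33 * ((x + y) ^ 4 * (x - y) ^ 8) + (x - y) ^ 12 =
      - 64 * (x ^ 12 - 33 * (x ^ 8 * y ^ 4) - 33 * (x ^ 4 * y ^ 8) + y ^ 12)"
    by algebra
  also have "\<dots> / 64 = bev (- w12) x y"
    by (simp add: w12_def mult.assoc)
  finally show "bev (macwilliams w12) x y = bev (- w12) x y" .
qed

lemma macwilliams_w24: "macwilliams w24 = w24"
proof (rule bev_eqI)
  fix x y :: complex
  have b: "bev w24 x y = (x * y * (x ^ 4 - y ^ 4)) ^ 4" for x y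
    by (simp add: w24_def w20_def power_mult_distrib)
  have "(rt2 * (x + y)) * (rt2 * (x - y)) * ((rt2 * (x + y)) ^ 4 - (rt2 * (x - y)) ^ 4) =
     (x + y) * (x - y) * ((x + y) ^ 4 - (x - y) ^ 4) / 8"
    by (simp add: power_mult_distrib rt2_powers mult_ac flip: diff_divide_distrib)
  also have "(x + y) * (x - y) * ((x + y) ^ 4 - (x - y) ^ 4) = 8 * (x * y * (x ^ 4 - y ^ 4))"
    by algebra
  finally show "bev (macwilliams w24) x y = bev w24 x y"
    by (simp add: b)
qed

lemma macwilliams_mult: "macwilliams (U * V) = macwilliams U * macwilliams V"
  by (rule bev_eqI) simp

lemma macwilliams_power: "macwilliams (U ^ k) = macwilliams U ^ k"
  by (rule bev_eqI) simp

text \<open>The witness is \<open>w12 * w8^b * w24^j\<close> with \<open>b = a - 3 j\<close>, of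
  degree \<open>12 + 8 b + 24 j = n\<close>. Only \<open>w12\<close> changes sign under the
  rotation, and \<open>w24^j\<close> supplies \<open>y^(4 j)\<close>.\<close>

lemma basis_element:
  assumes "3 * j \<le> a"
  defines "n \<equiv> 8 * a + 12"
  shows "\<exists>U. homogeneous n U \<and> y_div4 U \<and> macwilliams U = - U \<and> coeff (coeff U (4 * j)) (n - 4 * j) = 1 \<and>
    (\<forall>i<4 * j. coeff U i = 0)"
proof (intro exI conjI)
  define b where "b = a - 3 * j"
  have a: "a = b + 3 * j" using assms by (simp add: b_def)
  let ?U = "w12 * w8 ^ b * w24 ^ j"
  have "homogeneous (12 + b * 8 + j * 24) ?U"
    by (intro homogeneous_mult homogeneous_power homogeneous_w)
  then show "homogeneous n ?U" by (simp add: n_def a algebra_simps)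
  show "y_div4 ?U" by (intro y_div4_mult y_div4_power y_div4_w)
  show "macwilliams ?U = - ?U"
    by (simp add: macwilliams_mult macwilliams_power macwilliams_w8 macwilliams_w12 macwilliams_w24)
  have U: "?U = monom 1 (4 * j) * (w12 * w8 ^ b * w20 ^ j)"
    by (simp add: w24_def power_mult_distrib monom_power mult_ac)
  show "\<forall>i<4 * j. coeff ?U i = 0"
    unfolding U by (simp add: coeff_monom_mult)
  have "coeff ?U (4 * j) = coeff w12 0 * coeff w8 0 ^ b * coeff w20 0 ^ j"
    unfolding U by (simp add: coeff_monom_mult coeff_mult_0 coeff_0_power)
  also have "coeff w12 0 = monom 1 12"
    by (simp add: w12_def)
  also have "coeff w8 0 = monom 1 8"
    by (simp add: w8_def)
  also have "coeff w20 0 = monom 1 20"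
    by (simp add: w20_def coeff_mult_0 coeff_0_power monom_power mult_monom)
  also have "monom 1 12 * monom 1 8 ^ b * monom 1 20 ^ j = monom (1 :: complex) (n - 4 * j)"
    by (simp add: monom_power mult_monom n_def a algebra_simps)
  finally show "coeff (coeff ?U (4 * j)) (n - 4 * j) = 1" by simp
qed

text \<open>The elimination starts from \<open>w12 * w8^a\<close>. Each step subtracts a multiple of
  the basis element beginning at the next multiple of 4, which leaves the earlier coefficients
  unchanged.\<close>

lemma gap_exists:
  assumes "3 * j \<le> a"
  defines "n \<equiv> 8 * a + 12"
  shows "\<exists>V. homogeneous n V \<and> y_div4 V \<and> macwilliams V = - V \<and> coeff (coeff V 0) n = 1 \<and>
    (\<forall>i. 0 < i \<and> i \<le> 4 * j \<longrightarrow> coeff (coeff V i) (n - i) = 0)"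
  using assms(1)
proof (induction j)
  case 0
  then show ?case using basis_element[of 0 a] by (auto simp: n_def)
next
  case (Suc j)
  then obtain V where V: "homogeneous n V" "y_div4 V" "macwilliams V = - V" "coeff (coeff V 0) n = 1"
    "\<And>i. 0 < i \<Longrightarrow> i \<le> 4 * j \<Longrightarrow> coeff (coeff V i) (n - i) = 0"
    by auto
  obtain U where U: "homogeneous n U" "y_div4 U" "macwilliams U = - U"
    "coeff (coeff U (4 * Suc j)) (n - 4 * Suc j) = 1" "\<And>i. i < 4 * Suc j \<Longrightarrow> coeff U i = 0"
    using basis_element[OF Suc.prems] unfolding n_def by blast
  define c where "c = coeff (coeff V (4 * Suc j)) (n - 4 * Suc j)"
  have cU: "bconst c * U = monom (monom c 0) 0 * U"
    by (simp add: bconst_def monom_0)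
  let ?V = "V - bconst c * U"
  have "homogeneous (0 + n) (monom (monom c 0) 0 * U)"
    by (intro homogeneous_mult homogeneous_monom U) simp
  then have "homogeneous n ?V" using V(1) by (simp add: cU homogeneous_diff)
  moreover have "y_div4 ?V"
    unfolding cU by (intro y_div4_diff y_div4_mult y_div4_monom U V) simp
  moreover have "macwilliams ?V = - ?V"
    using bev_anti_invariant[OF V(3)] bev_anti_invariant[OF U(3)]
    by (intro bev_eqI) (simp add: algebra_simps)
  moreover have co: "coeff (coeff (bconst c * U) i) l = c * coeff (coeff U i) l" for i l
    by (simp add: bconst_def)
  moreover have "coeff (coeff ?V 0) n = 1"
    using V(4) U(5)[of 0] by (simp add: co)
  moreover have "coeff (coeff ?V i) (n - i) = 0" if i: "0 < i" "i \<le> 4 * Suc j" for i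
  proof (cases "4 dvd i")
    case True
    then consider "i \<le> 4 * j" | "i = 4 * Suc j" using i by fastforce
    then show ?thesis
    proof cases
      case 1
      then show ?thesis using V(5) U(5)[of i] i by (simp add: co)
    next
      case 2
      then show ?thesis using U(4) by (simp add: co) (simp add: c_def)
    qed
  next
    case False
    then have "coeff ?V i = 0" using \<open>y_div4 ?V\<close> by (auto simp: y_div4_def)
    then show ?thesis by simp
  qed
  ultimately show ?case by blast
qed

section \<open>Normalized forms and the value of the minimal index\<close>

lemma bconst_1: "bconst 1 = 1"
  by (simp add: bconst_def one_pCons)

text \<open>Padding the coefficients to a single sum from \<open>0\<close> to \<open>n\<close> gives
  the shape from which \<open>coeff_bsum\<close> reads them off.\<close>

lemma normalized_form_iff:
  "normalized_form n d A W \<longleftrightarrow> 1 \<le> d \<and> d \<le> n \<and> A d \<noteq> 0 \<and>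
    W = (\<Sum>i=0..n. bconst (if i = 0 then 1 else if i < d then 0 else A i) * bX ^ (n - i) * bY ^ i)"
proof -
  have eq: "bX ^ n + (\<Sum>i=d..n. bconst (A i) * bX ^ (n - i) * bY ^ i) =
     (\<Sum>i=0..n. bconst (if i = 0 then 1 else if i < d then 0 else A i) * bX ^ (n - i) * bY ^ i)"
    if "1 \<le> d"
  proof -
    have "(\<Sum>i=0..n. bconst (if i = 0 then 1 else if i < d then 0 else A i) * bX ^ (n - i) * bY ^ i)
      = bX ^ n + (\<Sum>i=1..n. bconst (if i = 0 then 1 else if i < d then 0 else A i) * bX ^ (n - i) * bY ^ i)"
      by (simp add: sum.atLeast_Suc_atMost bconst_1)
    also have "(\<Sum>i=1..n. bconst (if i = 0 then 1 else if i < d then 0 else A i) * bX ^ (n - i) * bY ^ i)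
      = (\<Sum>i=d..n. bconst (A i) * bX ^ (n - i) * bY ^ i)"
      using that by (intro sum.mono_neutral_cong_right) (auto simp: bconst_def)
    finally show ?thesis by simp
  qed
  show ?thesis
  proof (cases "1 \<le> d")
    case True
    show ?thesis unfolding normalized_form_def eq[OF True] by (rule refl)
  next
    case False
    then show ?thesis by (simp only: normalized_form_def simp_thms)
  qed
qed

lemma normalized_form_coeff:
  assumes "normalized_form n d A W"
  shows "1 \<le> d" "d \<le> n" "coeff (coeff W 0) n = 1"
    "\<And>i. 0 < i \<Longrightarrow> i < d \<Longrightarrow> coeff (coeff W i) (n - i) = 0"
    "coeff (coeff W d) (n - d) \<noteq> 0"
  using assms unfolding normalized_form_iff by (auto simp: coeff_bsum)

theorem theorem1p6:
  fixes W :: bpoly and n d :: nat and A :: "nat \<Rightarrow> complex"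
  assumes "formal_weight_enumerator n W"
    and "normalized_form n d A W"
  shows "int d \<le> 4 * \<lfloor>(real n - 12) / 24\<rfloor> + 4
       \<and> (extremal n W \<longrightarrow> int d = 4 * \<lfloor>(real n - 12) / 24\<rfloor> + 4)"
proof -
  have W: "homogeneous n W" "\<And>i j. coeff (coeff W i) j \<noteq> 0 \<Longrightarrow> 4 dvd i" "macwilliams W = - W"
    using assms(1) by (auto simp: formal_weight_enumerator_iff)
  note c = normalized_form_coeff[OF assms(2)]
  have "bev W 1 0 = (\<Sum>i\<in>{0}. coeff (coeff W i) (n - i) * 1 ^ (n - i) * 0 ^ i)"
    unfolding bev_homogeneous[OF W(1)] by (intro sum.mono_neutral_right) auto
  then have n8: "n mod 8 = 4"
    using c(3) by (intro degree_mod_8[OF W]) auto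
  have "d < n" by (rule index_less_degree[OF W(1) W(3) n8 c(3-5)])
  have "4 dvd d" using W(2) c(5) by blast
  then obtain q where q: "d = 4 * q" by blast
  \<comment> \<open>\<open>d\<close> is a positive multiple of 4 below \<open>n\<close>; with the
    congruence modulo 8 this gives \<open>n \<ge> 12\<close>.\<close>
  have "4 < n" using \<open>d < n\<close> c(1) q by (cases q) simp_all
  with n8 have "n = 8 * (n div 8 - 1) + 12" by presburger
  then obtain a where a: "n = 8 * a + 12" by blast
  define k where "k = a div 3"
  have fl: "\<lfloor>(real n - 12) / 24\<rfloor> = int k"
  proof -
    have "(real n - 12) / 24 = real a / real 3" by (simp add: a)
    then show ?thesis unfolding k_def by (simp only: floor_divide_of_nat_eq)
  qed
  have "6 * d \<le> n + 12"
    by (rule minimal_index_bound[OF W c(3) _ c(4-5)]) (use c(1) in simp_all)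
  \<comment> \<open>The bound reads \<open>24 q \<le> 8 a + 24\<close>, so
    \<open>q - 1 \<le> a / 3\<close>, and integrality gives the floor.\<close>
  then have "q \<le> k + 1" unfolding k_def by (simp add: q a)
  then have up: "d \<le> 4 * k + 4" by (simp add: q)
  have low: "4 * k + 4 \<le> d" if "extremal n W"
  proof -
    from that obtain d' A' where d': "normalized_form n d' A' W"
      and max: "\<And>V e B. formal_weight_enumerator n V \<Longrightarrow> normalized_form n e B V \<Longrightarrow> e \<le> d'"
      unfolding extremal_def by blast
    note c' = normalized_form_coeff[OF d']
    \<comment> \<open>Both are the first positive index with nonzero coefficient.\<close>
    have "d' = d"
      using c(1,4,5) c'(1,4,5) by (metis less_le_trans less_one linorder_neqE_nat)
    have "3 * k \<le> a" by (simp add: k_def)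
    then obtain V where V: "homogeneous n V" "y_div4 V" "macwilliams V = - V" "coeff (coeff V 0) n = 1"
      "\<And>i. 0 < i \<Longrightarrow> i \<le> 4 * k \<Longrightarrow> coeff (coeff V i) (n - i) = 0"
      using gap_exists[of k a] unfolding a by blast
    have fV: "formal_weight_enumerator n V"
      unfolding formal_weight_enumerator_iff using V(1-3) unfolding y_div4_def
      by (metis coeff_0)
    define P where "P i \<longleftrightarrow> 0 < i \<and> coeff (coeff V i) (n - i) \<noteq> 0" for i
    \<comment> \<open>Otherwise \<open>V = x^n\<close>, which vanishes at \<open>(0, 1)\<close> but
      not at the rotated point.\<close>
    have "\<exists>i. P i"
    proof (rule ccontr)
      assume "\<nexists>i. P i"
      then have "coeff (coeff V i) (n - i) = 0" if "0 < i" for i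
        using that unfolding P_def by blast
      then have "bev V x y = (\<Sum>i\<in>{0}. coeff (coeff V i) (n - i) * x ^ (n - i) * y ^ i)" for x y
        unfolding bev_homogeneous[OF V(1)] by (intro sum.mono_neutral_right) auto
      then have "bev V x y = x ^ n" for x y using V(4) by simp
      with bev_anti_invariant[OF V(3), of 0 1] have "rt2 ^ n = 0" using \<open>4 < n\<close> by simp
      then show False by (simp add: rt2_def)
    qed
    define e where "e = (LEAST i. P i)"
    have e: "P e" unfolding e_def using \<open>\<exists>i. P i\<close> by (rule LeastI_ex)
    have less: "coeff (coeff V i) (n - i) = 0" if "0 < i" "i < e" for i
      using that not_less_Least[of i P] unfolding e_def P_def by blast
    have "e \<le> n"
      using e V(1) unfolding P_def homogeneous_def by (metis le_add1)
    have co: "coeff (coeff V i) (n - i) =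
        (if i = 0 then 1 else if i < e then 0 else coeff (coeff V i) (n - i))" for i
      using V(4) less[of i] by simp
    have "normalized_form n e (\<lambda>i. coeff (coeff V i) (n - i)) V"
      unfolding normalized_form_iff
    proof (intro conjI)
      show "V = (\<Sum>i=0..n. bconst (if i = 0 then 1 else if i < e then 0
          else coeff (coeff V i) (n - i)) * bX ^ (n - i) * bY ^ i)"
        unfolding co[symmetric] by (rule homogeneous_expand[OF V(1)])
    qed (use e \<open>e \<le> n\<close> in \<open>auto simp: P_def\<close>)
    with max fV have "e \<le> d" unfolding \<open>d' = d\<close> by blast
    moreover have "4 * k < e" using e V(5)[of e] by (auto simp: P_def not_less[symmetric])
    \<comment> \<open>Divisibility of \<open>d\<close> by 4 raises \<open>d > 4 k\<close> to
      \<open>d \<ge> 4 k + 4\<close>.\<close>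
    ultimately have "4 * k < 4 * q" by (simp add: q)
    then have "k < q" by simp
    then show ?thesis by (simp add: q)
  qed
  show ?thesis unfolding fl using up low by auto
qed

end
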